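(* Let $m, d, k$ be integers such that $m \geq 4$, $1 \leq d \leq m-1$, $d \neq m/2$, and $k \geq 3$ if $d < m/2$ and $k \geq 4$ if $d > m/2$. Let \[ B = [0,m-1] \setminus \{d\}, \qquad L = \{m-d, 2m-d, \ldots, km-d\}, \qquad a^* = (k+1)m - 2d, \] \[ A^* = B \cup L \cup (a^* - B), \qquad A = A^* \cup \{m\}. \] Then $A$ is an MSTD set of integers, i.e. $|A+A| > |A-A|$.
   Context: For integers $a,b$, $[a,b]$ denotes the interval of integers $\{a,a+1,\ldots,b\}$. For sets $A,B$ of integers, $A+B=\{a+b : a\in A, b\in B\}$, $A-B=\{a-b : a\in A, b\in B\}$, and for an integer $x$, $x - B = \{x-b : b\in B\}$. $|A|$ denotes cardinality. A finite set $A$ is called an MSTD set (more sums than differences) if $|A+A|>|A-A|$. *)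

theory Defs
  imports Main "HOL-Library.Set_Algebras"
begin

text \<open>
  Set_Algebras supplies the sumset \<open>A + B\<close>, but \<open>A - B\<close> on sets
  is the set-theoretic difference, so the arithmetic difference set needs its own name.
\<close>

definition difference_set :: "int set \<Rightarrow> int set \<Rightarrow> int set"
  where "difference_set A B = {c. \<exists>a\<in>A. \<exists>b\<in>B. c = a - b}"

definition MSTD :: "int set \<Rightarrow> bool"
  where "MSTD A \<longleftrightarrow> finite A \<and> card (A + A) > card (difference_set A A)"

end

theory Submission
  imports Defs
begin

text \<open>
  The argument is Nathanson's perturbation of a symmetric set. A finite set \<open>S\<close> with \<open>S = c - S\<close>
  satisfies \<open>S + S = c + (S - S)\<close>, so it has as many sums as differences. Hence adjoining an element
  \<open>m\<close> produces an MSTD set as soon as \<open>m\<close> contributes a new sum but no new difference; this is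
  \<open>MSTD_insert_symmetric\<close>, where the new sum is \<open>2m\<close>.

  Here \<open>S = B \<union> L \<union> (c - B)\<close> with \<open>c = (k + 1)m - 2d\<close>. It is symmetric about \<open>c/2\<close> because
  \<open>c - (jm - d) = (k + 1 - j)m - d\<close> lies in \<open>L\<close>. The number \<open>2m\<close> is not in \<open>S + S\<close>: the lower bound
  on \<open>k\<close> puts \<open>c - B\<close> above \<open>2m\<close>, \<open>B + B\<close> stays below \<open>2m\<close>, a sum in \<open>B + L\<close> is congruent to 0
  modulo \<open>m\<close> only if its \<open>B\<close>-summand is the missing element \<open>d\<close>, and a sum in \<open>L + L\<close> is congruent to
  0 modulo \<open>m\<close> only if \<open>2d = m\<close>.

  The differences \<open>m - x\<close> are not new. For \<open>x\<close> in \<open>B\<close> or \<open>L\<close> they lie in \<open>B - 0\<close>, \<open>0 - L\<close> or \<open>L - L\<close>,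
  except for the value \<open>d\<close>, which takes a short case distinction. For \<open>x = c - b\<close> the
  symmetry turns a representation \<open>m + b = u + v\<close> with \<open>u, v \<in> S\<close> into \<open>m - x = u - (c - v)\<close>, and
  \<open>m + b\<close> is a sum of an element of \<open>B\<close> and one of \<open>B \<union> L\<close>.
\<close>

lemma difference_setI: "a \<in> A \<Longrightarrow> b \<in> B \<Longrightarrow> a - b \<in> difference_set A B"
  unfolding difference_set_def by blast

lemma difference_set_uminus: "x \<in> difference_set A B \<Longrightarrow> - x \<in> difference_set B A"
  unfolding difference_set_def by force

lemma sumset_symmetric:
  assumes "\<And>x. x \<in> S \<Longrightarrow> c - x \<in> S"
  shows "S + S = (+) c ` difference_set S S"
proof (rule set_eqI, rule iffI)
  fix z
  assume "z \<in> S + S"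
  then obtain x y where xy: "x \<in> S" "y \<in> S" "z = x + y"
    by (auto elim: set_plus_elim)
  then have "x - (c - y) \<in> difference_set S S"
    using assms by (intro difference_setI)
  moreover have "z = c + (x - (c - y))"
    using xy by simp
  ultimately show "z \<in> (+) c ` difference_set S S"
    by blast
next
  fix z
  assume "z \<in> (+) c ` difference_set S S"
  then obtain x y where xy: "x \<in> S" "y \<in> S" "z = c + (x - y)"
    by (auto simp: difference_set_def)
  then have "x + (c - y) \<in> S + S"
    using assms by (intro set_plus_intro)
  moreover have "z = x + (c - y)"
    using xy by simp
  ultimately show "z \<in> S + S"
    by simp
qed

lemma MSTD_insert_symmetric:
  assumes fin: "finite S"
    and sym: "\<And>x. x \<in> S \<Longrightarrow> c - x \<in> S"
    and new_sum: "m + m \<notin> S + S"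
    and old_diff: "\<And>x. x \<in> S \<Longrightarrow> m - x \<in> difference_set S S"
    and "S \<noteq> {}"
  shows "MSTD (insert m S)"
proof -
  have diff: "difference_set (insert m S) (insert m S) \<subseteq> difference_set S S"
  proof
    fix z
    assume "z \<in> difference_set (insert m S) (insert m S)"
    then obtain x y where xy: "x \<in> insert m S" "y \<in> insert m S" "z = x - y"
      unfolding difference_set_def by blast
    consider "x = m" "y = m" | "x \<in> S" "y \<in> S" | "x = m" "y \<in> S" | "x \<in> S" "y = m"
      using xy by blast
    then show "z \<in> difference_set S S"
    proof cases
      case 1
      with xy \<open>S \<noteq> {}\<close> show ?thesis
        by (force simp: difference_set_def)
    next
      case 2
      with xy show ?thesis
        by (simp add: difference_setI)
    next
      case 3
      with xy old_diff show ?thesis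
        by simp
    next
      case 4
      with xy difference_set_uminus[OF old_diff, of x] show ?thesis
        by simp
    qed
  qed
  have fin': "finite (insert m S + insert m S)" "finite (S + S)"
    using fin by (auto intro: finite_set_plus)
  have eq: "card (S + S) = card (difference_set S S)"
    by (simp add: sumset_symmetric[OF sym] card_image)
  have "finite (difference_set S S)"
    using fin'(2) by (simp add: sumset_symmetric[OF sym] finite_image_iff)
  then have "card (difference_set (insert m S) (insert m S)) \<le> card (S + S)"
    using diff by (simp add: eq card_mono)
  also have "S + S \<subset> insert m S + insert m S"
    using new_sum set_plus_mono2[of S "insert m S" S "insert m S"]
    by (blast intro: set_plus_intro)
  then have "card (S + S) < card (insert m S + insert m S)"
    using fin'(1) by (rule psubset_card_mono[rotated])
  finally show ?thesis
    using fin by (simp add: MSTD_def)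
qed

theorem theorem1:
  fixes m d k a_star :: int and B L A_star A :: "int set"
  assumes "m \<ge> 4"
    and "1 \<le> d" and "d \<le> m - 1"
    and "2 * d \<noteq> m"
    and "2 * d < m \<Longrightarrow> k \<ge> 3"
    and "2 * d > m \<Longrightarrow> k \<ge> 4"
    and "B = {0..m - 1} - {d}"
    and "L = {j * m - d | j. 1 \<le> j \<and> j \<le> k}"
    and "a_star = (k + 1) * m - 2 * d"
    and "A_star = B \<union> L \<union> {a_star - b | b. b \<in> B}"
    and "A = A_star \<union> {m}"
  shows "MSTD A"
proof -
  note m = \<open>m \<ge> 4\<close> and d = \<open>1 \<le> d\<close> \<open>d \<le> m - 1\<close> \<open>2 * d \<noteq> m\<close>
  have k3: "k \<ge> 3"
    using assms(4-6) by linarith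
  have B_iff: "b \<in> B \<longleftrightarrow> 0 \<le> b \<and> b < m \<and> b \<noteq> d" for b
    using assms(7) by auto
  have B_in: "b \<in> A_star" if "0 \<le> b" "b < m" "b \<noteq> d" for b
    using that assms(10) B_iff by blast
  have L_in: "j * m - d \<in> A_star" if "1 \<le> j" "j \<le> k" for j
    using that assms(8,10) by blast
  have L1: "m - d \<in> A_star" and L2: "2 * m - d \<in> A_star"
    using L_in[of 1] L_in[of 2] k3 by simp_all
  have A_star_cases: "x \<in> B \<or> (\<exists>j. 1 \<le> j \<and> j \<le> k \<and> x = j * m - d) \<or> (\<exists>b\<in>B. x = a_star - b)"
    if "x \<in> A_star" for x
    using that assms(8,10) by blast

  have "finite A_star"
  proof -
    have "L = (\<lambda>j. j * m - d) ` {1..k}"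
      using assms(8) by auto
    moreover have "{a_star - b | b. b \<in> B} = (\<lambda>b. a_star - b) ` B"
      by blast
    ultimately show ?thesis
      using assms(7,10) by simp
  qed

  have sym: "a_star - x \<in> A_star" if "x \<in> A_star" for x
    using A_star_cases[OF that]
  proof (elim disjE exE bexE conjE)
    assume "x \<in> B"
    then show ?thesis
      using assms(10) by blast
  next
    fix j
    assume j: "1 \<le> j" "j \<le> k" "x = j * m - d"
    then have eq: "a_star - x = (k + 1 - j) * m - d"
      by (simp add: assms(9) algebra_simps)
    show ?thesis
      unfolding eq using j by (intro L_in) auto
  next
    fix b
    assume "b \<in> B" "x = a_star - b"
    then show ?thesis
      using assms(10) by simp
  qed

  have a_star: "a_star = k * m + m - 2 * d"
    by (simp add: assms(9) algebra_simps)
  have large: "a_star - b > 2 * m" if "b \<in> B" for b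
  proof (cases "2 * d < m")
    case True
    then have "3 * m \<le> k * m"
      using assms(5) m by (intro mult_right_mono) auto
    then show ?thesis
      using True that unfolding a_star B_iff by linarith
  next
    case False
    then have "4 * m \<le> k * m"
      using assms(4,6) m by (intro mult_right_mono) auto
    then show ?thesis
      using d that unfolding a_star B_iff by linarith
  qed
  have L_pos: "j * m - d > 0" if "1 \<le> j" for j
    using mult_right_mono[OF that, of m] m d by linarith
  have nonneg: "x \<ge> 0" if "x \<in> A_star" for x
    using A_star_cases[OF that] large m L_pos by (fastforce simp: B_iff)

  have small: "x \<in> B \<or> (\<exists>j. x = j * m - d)" if "x \<in> A_star" "x \<le> 2 * m" for x
    using A_star_cases[OF that(1)] large that(2) by fastforce
  have no_BL: False if "b \<in> B" "b + (j * m - d) = 2 * m" for b j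
  proof -
    have "b - d = (2 - j) * m"
      using that(2) by (simp add: algebra_simps)
    then have "m dvd b - d"
      by simp
    then show False
      using that(1) d zdvd_imp_le[of m "b - d"] zdvd_imp_le[of m "d - b"]
      by (cases b d rule: linorder_cases) (auto simp: B_iff dvd_diff_commute)
  qed
  have no_LL: False if "(i * m - d) + (j * m - d) = 2 * m" for i j
  proof -
    define t where "t = i + j - 2"
    have t: "2 * d = t * m"
      using that by (simp add: t_def algebra_simps)
    then have "0 < t * m" "t * m < 2 * m"
      using d by linarith+
    then have "0 < t" "t < 2"
      using m by (simp_all add: zero_less_mult_iff)
    then have "t = 1"
      by linarith
    with t d show False
      by simp
  qed
  have new_sum: "m + m \<notin> A_star + A_star"
  proof
    assume "m + m \<in> A_star + A_star"
    then obtain x y where xy: "x \<in> A_star" "y \<in> A_star" "x + y = 2 * m"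
      by (auto elim!: set_plus_elim)
    then have "x \<in> B \<or> (\<exists>i. x = i * m - d)" "y \<in> B \<or> (\<exists>j. y = j * m - d)"
      using small[of x] small[of y] nonneg[of x] nonneg[of y] by auto
    then show False
      using xy(3) no_BL no_LL by (fastforce simp: B_iff add.commute)
  qed

  let ?D = "difference_set A_star A_star"
  have diffI: "z \<in> ?D" if "x \<in> A_star" "y \<in> A_star" "z = x - y" for x y z
    using that difference_setI by simp
  have zero: "0 \<in> A_star"
    using m d by (intro B_in) auto

  have d_diff: "d \<in> ?D"
  proof -
    consider "d = 1" | "d = m - 1" | "2 \<le> d" "d \<le> m - 2"
      using d by linarith
    then show ?thesis
    proof cases
      case 1
      then show ?thesis
        using m by (intro diffI[of 3 2] B_in) auto
    next
      case 2
      \<comment> \<open>Two elements of \<open>B\<close> do not suffice here: in \<open>{0..m - 1}\<close> only \<open>0\<close> and \<open>m - 1 = d\<close> are that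
        far apart, and \<open>d\<close> is missing from \<open>B\<close>.\<close>
      then show ?thesis
        using m by (intro diffI[OF L2 B_in[of 2]]) auto
    next
      case 3
      then show ?thesis
        by (intro diffI[of "d + 1" 1] B_in) auto
    qed
  qed

  have m_plus: "\<exists>u\<in>A_star. \<exists>v\<in>A_star. m + b = u + v" if "b \<in> B" for b
  proof -
    consider "b = 0" "d = 1 \<or> d = m - 1" | "b = 0" "d \<noteq> 1" "d \<noteq> m - 1"
      | "b \<noteq> 0" "b + d < m" | "b + d \<ge> m"
      using d by linarith
    then show ?thesis
    proof cases
      case 1
      then have "2 \<in> A_star" "m - 2 \<in> A_star" "m + b = 2 + (m - 2)"
        using m by (auto intro!: B_in)
      then show ?thesis
        by blast
    next
      case 2
      then have "1 \<in> A_star" "m - 1 \<in> A_star" "m + b = 1 + (m - 1)"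
        using m by (auto intro!: B_in)
      then show ?thesis
        by blast
    next
      case 3
      then have "b + d \<in> A_star" "m + b = (m - d) + (b + d)"
        using that d by (auto intro!: B_in simp: B_iff)
      then show ?thesis
        using L1 by blast
    next
      case 4
      then have "b + d - m \<in> A_star" "m + b = (2 * m - d) + (b + d - m)"
        using that d by (auto intro!: B_in simp: B_iff)
      then show ?thesis
        using L2 by blast
    qed
  qed

  have old_diff: "m - x \<in> ?D" if "x \<in> A_star" for x
    using A_star_cases[OF that]
  proof (elim disjE exE bexE conjE)
    assume x: "x \<in> B"
    consider "x = 0" | "x \<noteq> 0" "m - x = d" | "x \<noteq> 0" "m - x \<noteq> d"
      by blast
    then show ?thesis
    proof cases
      case 1
      then show ?thesis
        by (intro diffI[OF L2 L1]) simp
    next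
      case 2
      then show ?thesis
        using d_diff by simp
    next
      case 3
      then show ?thesis
        using x by (intro diffI[OF B_in[of "m - x"] zero]) (auto simp: B_iff)
    qed
  next
    fix j
    assume j: "1 \<le> j" "j \<le> k" "x = j * m - d"
    show ?thesis
    proof (cases "j = 1")
      case True
      then show ?thesis
        using j d_diff by simp
    next
      case False
      then show ?thesis
        using j by (intro diffI[OF zero L_in[of "j - 1"]]) (auto simp: algebra_simps)
    qed
  next
    fix b
    assume b: "b \<in> B" "x = a_star - b"
    obtain u v where "u \<in> A_star" "v \<in> A_star" "m + b = u + v"
      using m_plus[OF b(1)] by blast
    then show ?thesis
      using b by (intro diffI[of u "a_star - v"] sym) auto
  qed

  have "MSTD (insert m A_star)"
    using \<open>finite A_star\<close> sym new_sum old_diff zero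
    by (intro MSTD_insert_symmetric) auto
  then show ?thesis
    by (simp add: assms(11))
qed

end
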